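(* Let $a$ be a positive integer with $a\equiv 3$ or $7\pmod{20}$. For every integer $b\ge \bar b(a)-1$ with $b\ge 1$, $$\#S(a,b)=\begin{cases}(b-1)\cdot V(a) & \text{if } V(a,2)=V(a),\\ b\cdot V(a)+1 & \text{if } V(a,2)>V(a),\end{cases}$$ and one of the two cases always occurs.
   Context: For an integer $a\ge 1$, the tetration ${}^{b}a$ is defined by ${}^{1}a=a$ and ${}^{b}a=a^{({}^{b-1}a)}$ for $b\ge 2$. For an integer $a\ge 2$ not divisible by $10$ and $b\ge 1$, the number of stable digits $\#S(a,b)$ is the non-negative integer $n$ such that ${}^{b}a\equiv {}^{b+1}a \pmod{10^{n}}$ and ${}^{b}a\not\equiv {}^{b+1}a\pmod{10^{n+1}}$. The congruence speed of $a$ at height $b$ is $V(a,b):=\#S(a,b)-\#S(a,b-1)$ for $b\ge 2$ and $V(a,1):=\#S(a,1)$, so that $\#S(a,b)=\sum_{i=1}^{b}V(a,i)$. It is known that $V(a,b)$ is constant for all sufficiently large $b$; this eventual constant value is the constant congruence speed $V(a)$, and $\bar b(a)$ denotes the smallest $b\ge 1$ such that $V(a,b)=V(a,b+k)$ for all integers $k\ge 0$. *)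

theory Defs
  imports "HOL-Number_Theory.Cong"
begin

text \<open>Only heights \<open>b \<ge> 1\<close> matter; the value at height 0 is chosen so that
  \<open>tetration a 1 = a\<close>.\<close>

primrec tetration :: "nat \<Rightarrow> nat \<Rightarrow> nat" where
  "tetration a 0 = 1"
| "tetration a (Suc b) = a ^ tetration a b"

definition stable_digits :: "nat \<Rightarrow> nat \<Rightarrow> nat" where
  "stable_digits a b =
    (THE n. [tetration a b = tetration a (b + 1)] (mod 10 ^ n) \<and>
            \<not> [tetration a b = tetration a (b + 1)] (mod 10 ^ (n + 1)))"

text \<open>Integer-valued, so that the difference is not truncated.
  The value at height \<open>b = 0\<close> is irrelevant.\<close>

definition congruence_speed :: "nat \<Rightarrow> nat \<Rightarrow> int" where
  "congruence_speed a b =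
    (if b \<ge> 2 then int (stable_digits a b) - int (stable_digits a (b - 1))
     else int (stable_digits a 1))"

definition constant_congruence_speed :: "nat \<Rightarrow> int" where
  "constant_congruence_speed a =
    (THE v. \<forall>\<^sub>F b in sequentially. congruence_speed a b = v)"

definition min_stable_height :: "nat \<Rightarrow> nat" where
  "min_stable_height a =
    (LEAST b. b \<ge> 1 \<and> (\<forall>k. congruence_speed a b = congruence_speed a (b + k)))"

end

theory Submission
  imports Defs "HOL-Computational_Algebra.Primes"
begin

text \<open>
  Put \<open>t = v\<^sub>2(a + 1)\<close>, \<open>s = v\<^sub>5(a\<^sup>2 + 1)\<close> and \<open>d\<^sub>b = \<^sup>b\<^sup>+\<^sup>1a - \<^sup>ba\<close>, so that \<open>#S(a,b)\<close> is the
  minimum of \<open>v\<^sub>2(d\<^sub>b)\<close> and \<open>v\<^sub>5(d\<^sub>b)\<close>. Since \<open>d\<^sub>b\<^sub>+\<^sub>1\<close> is a power of \<open>a\<close>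
  times \<open>a ^ d\<^sub>b - 1\<close>, lifting the exponent gives \<open>v\<^sub>2(d\<^sub>b) = b t + 1\<close> and
  \<open>v\<^sub>5(d\<^sub>b) = (b - 1) s\<close> for \<open>b \<ge> 1\<close>. If \<open>s \<le> t\<close>, the second one is always the minimum. If
  \<open>s > t\<close>, the first one is eventually the minimum, while \<open>V(a,2) = min (2 t + 1) s > t\<close>.
\<close>

section \<open>Lifting the exponent for \<open>x ^ n - 1\<close>\<close>

lemma sum_powers_cong_card:
  fixes x d :: int
  assumes "[x = 1] (mod d)"
  shows "[(\<Sum>i<n. x ^ i) = int n] (mod d)"
proof -
  have "[(\<Sum>i<n. x ^ i) = (\<Sum>i<n. 1 ^ i)] (mod d)"
    by (intro cong_sum cong_pow assms)
  then show ?thesis by simp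
qed

text \<open>Modulo \<open>d\<^sup>2\<close> the binomial expansion of \<open>(1 + w) ^ m\<close>
  stops after the linear term. The factor 2 avoids halving \<open>n * (n - 1)\<close>.\<close>

lemma sum_powers_cong_square:
  fixes w d :: int
  assumes "d dvd w"
  shows "[2 * (\<Sum>i<n. (1 + w) ^ i) = 2 * int n + w * (int n * (int n - 1))] (mod d\<^sup>2)"
proof (induction n)
  case 0
  then show ?case by simp
next
  case (Suc n)
  have "[(1 + w) ^ m = 1 + int m * w] (mod d\<^sup>2)" for m
  proof (induction m)
    case 0
    then show ?case by simp
  next
    case (Suc m)
    have "[(1 + w) * (1 + w) ^ m = (1 + w) * (1 + int m * w)] (mod d\<^sup>2)"
      using Suc by (intro cong_mult) auto
    also have "[(1 + w) * (1 + int m * w) = 1 + int (Suc m) * w] (mod d\<^sup>2)"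
    proof -
      have "(1 + w) * (1 + int m * w) - (1 + int (Suc m) * w) = int m * w\<^sup>2"
        by (simp add: algebra_simps power2_eq_square)
      then show ?thesis
        using assms by (simp add: cong_iff_dvd_diff)
    qed
    finally show ?case by simp
  qed
  then have "[2 * (1 + w) ^ n = 2 * (1 + int n * w)] (mod d\<^sup>2)"
    by (intro cong_mult) auto
  from cong_add[OF Suc this] show ?case
    by (simp add: algebra_simps)
qed

text \<open>The sum is the cofactor of \<open>x - 1\<close> in \<open>x ^ p - 1\<close>, so taking a
  \<open>p\<close>-th power gains exactly one factor \<open>p\<close>. For \<open>p = 2\<close> it
  is \<open>x + 1\<close>, whence the condition modulo 4.\<close>

lemma multiplicity_sum_powers_prime:
  fixes p :: nat and x :: int
  assumes "prime p" and "int p dvd x - 1" and "p = 2 \<Longrightarrow> 4 dvd x - 1"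
  shows "multiplicity (int p) (\<Sum>i<p. x ^ i) = 1"
proof -
  define S where "S = (\<Sum>i<p. x ^ i)"
  have "[S = int p] (mod int p)"
    unfolding S_def using assms(2) by (intro sum_powers_cong_card) (simp add: cong_iff_dvd_diff)
  then have p_dvd: "int p dvd S"
    by (simp add: cong_def mod_eq_0_iff_dvd)
  have not_dvd: "\<not> (int p)\<^sup>2 dvd S"
  proof (cases "p = 2")
    case True
    then have "S = 2 + (x - 1)"
      unfolding S_def by (simp add: numeral_2_eq_2)
    moreover have "4 dvd x - 1"
      using assms(3) True .
    ultimately show ?thesis
      using True by simp presburger
  next
    case False
    have "odd p"
      using assms(1) False primes_dvd_imp_eq two_is_prime_nat by blast
    \<comment> \<open>One factor \<open>p\<close> comes from \<open>x - 1\<close> and one is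
      explicit, so modulo \<open>p\<^sup>2\<close> only \<open>2 * p\<close> survives.\<close>
    then have "(int p)\<^sup>2 dvd (x - 1) * (int p * (int p - 1))"
      using assms(2) by (simp add: power2_eq_square mult_dvd_mono)
    moreover have "[2 * S = 2 * int p + (x - 1) * (int p * (int p - 1))] (mod (int p)\<^sup>2)"
      unfolding S_def using sum_powers_cong_square[OF assms(2), of p] by simp
    ultimately have "(int p)\<^sup>2 dvd 2 * S \<longleftrightarrow> (int p)\<^sup>2 dvd 2 * int p"
      by (metis cong_dvd_iff dvd_add_left_iff)
    also have "\<dots> \<longleftrightarrow> int p dvd 2"
      using assms(1) by (simp add: power2_eq_square prime_gt_0_nat)
    also have "\<dots> \<longleftrightarrow> p dvd 2"
      by presburger
    finally show ?thesis
      using assms(1) False primes_dvd_imp_eq two_is_prime_nat by (metis dvd_mult)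
  qed
  show ?thesis
    using p_dvd not_dvd unfolding S_def[symmetric]
    by (intro multiplicity_eqI) (auto simp: numeral_2_eq_2)
qed

text \<open>Lifting the exponent, by removing the factors \<open>p\<close> of \<open>n\<close> one at a time.\<close>

lemma multiplicity_power_minus_1:
  fixes p n :: nat and x :: int
  assumes "prime p" and "int p dvd x - 1" and "p = 2 \<Longrightarrow> 4 dvd x - 1"
    and "x \<noteq> 1" and "n > 0"
  shows "x ^ n \<noteq> 1 \<and>
    multiplicity (int p) (x ^ n - 1) = multiplicity (int p) (x - 1) + multiplicity p n"
  using \<open>n > 0\<close>
proof (induction n rule: less_induct)
  case (less n)
  have prime_p: "prime_elem (int p)"
    using assms(1) by simp
  show ?case
  proof (cases "p dvd n")
    case False
    \<comment> \<open>Here the cofactor of \<open>x - 1\<close> is congruent to \<open>n\<close>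
      modulo \<open>p\<close>, so it contributes no factor \<open>p\<close>.\<close>
    have "[(\<Sum>i<n. x ^ i) = int n] (mod int p)"
      using assms(2) by (intro sum_powers_cong_card) (simp add: cong_iff_dvd_diff)
    then have ndvd: "\<not> int p dvd (\<Sum>i<n. x ^ i)"
      using False by (simp add: cong_dvd_iff)
    then have "(\<Sum>i<n. x ^ i) \<noteq> 0"
      by auto
    moreover have "multiplicity (int p) (\<Sum>i<n. x ^ i) = 0" "multiplicity p n = 0"
      using ndvd False by (simp_all add: not_dvd_imp_multiplicity_0)
    moreover have "x ^ n - 1 = (x - 1) * (\<Sum>i<n. x ^ i)"
      by (rule power_diff_1_eq)
    ultimately show ?thesis
      using \<open>x \<noteq> 1\<close> prime_p
      by (simp add: prime_elem_multiplicity_mult_distrib) (metis diff_0 eq_iff_diff_eq_0 no_zero_divisors)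
  next
    case True
    then obtain m where n: "n = p * m" ..
    define y where "y = x ^ m"
    have "m > 0" "m < n"
      using less.prems prime_gt_1_nat[OF assms(1)] n by auto
    then have IH: "y \<noteq> 1"
      "multiplicity (int p) (y - 1) = multiplicity (int p) (x - 1) + multiplicity p m"
      using less.IH unfolding y_def by auto
    \<comment> \<open>The divisibility hypotheses on \<open>x - 1\<close> pass to its multiple
      \<open>y - 1\<close>.\<close>
    have "x - 1 dvd y - 1"
      unfolding y_def by (simp add: power_diff_1_eq)
    then have mult_S: "multiplicity (int p) (\<Sum>i<p. y ^ i) = 1"
      using assms by (intro multiplicity_sum_powers_prime) (auto intro: dvd_trans)
    then have S_nonzero: "(\<Sum>i<p. y ^ i) \<noteq> 0"
      by auto
    have factor: "x ^ n - 1 = (y - 1) * (\<Sum>i<p. y ^ i)"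
      unfolding n y_def by (metis mult.commute power_diff_1_eq power_mult)
    have "multiplicity p n = Suc (multiplicity p m)"
      using \<open>m > 0\<close> assms(1) unfolding n by (intro multiplicity_times_same) auto
    then have "multiplicity (int p) (x ^ n - 1) = multiplicity (int p) (x - 1) + multiplicity p n"
      unfolding factor using IH S_nonzero mult_S prime_p
      by (simp add: prime_elem_multiplicity_mult_distrib)
    moreover have "x ^ n - 1 \<noteq> 0"
      unfolding factor using IH S_nonzero by simp
    ultimately show ?thesis
      by simp
  qed
qed

lemma multiplicity_int: "multiplicity (int p) (int n) = multiplicity p n"
proof -
  have "int p ^ k dvd int n \<longleftrightarrow> p ^ k dvd n" for k
    by (metis int_dvd_int_iff of_nat_power)
  then show ?thesis
    by (simp add: multiplicity_def)
qed

lemma multiplicity_power_minus_1_nat: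
  fixes p n x :: nat
  assumes "prime p" and "p dvd x - 1" and "p = 2 \<Longrightarrow> 4 dvd x - 1"
    and "x > 1" and "n > 0"
  shows "multiplicity p (x ^ n - 1) = multiplicity p (x - 1) + multiplicity p n"
proof -
  have int_diff: "int x - 1 = int (x - 1)" "int x ^ n - 1 = int (x ^ n - 1)"
    using \<open>x > 1\<close> by (simp_all add: of_nat_diff)
  have "int p dvd int x - 1"
    unfolding int_diff using assms(2) by simp
  moreover have "4 dvd int x - 1" if "p = 2"
    unfolding int_diff using assms(3)[OF that] by presburger
  ultimately have "multiplicity (int p) (int x ^ n - 1) =
      multiplicity (int p) (int x - 1) + multiplicity p n"
    using multiplicity_power_minus_1[of p "int x" n] assms by auto
  then show ?thesis
    unfolding int_diff multiplicity_int .
qed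

section \<open>Differences of consecutive towers and stable digits\<close>

lemma tetration_less_Suc:
  assumes "a > 1"
  shows "tetration a b < tetration a (Suc b)"
  using assms by (simp add: power_gt_expt)

text \<open>The exponents of the two towers differ by the previous difference. This gives a
  recursion for the valuations to which lifting the exponent applies.\<close>

lemma tetration_diff_Suc:
  assumes "a > 1"
  shows "tetration a (Suc (Suc b)) - tetration a (Suc b) =
    tetration a (Suc b) * (a ^ (tetration a (Suc b) - tetration a b) - 1)"
proof -
  have "tetration a (Suc b) = tetration a b + (tetration a (Suc b) - tetration a b)"
    using tetration_less_Suc[OF assms, of b] by simp
  then have "tetration a (Suc (Suc b)) =
      tetration a (Suc b) * a ^ (tetration a (Suc b) - tetration a b)"
    by (metis power_add tetration.simps(2))
  then show ?thesis
    by (simp add: diff_mult_distrib2)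
qed

text \<open>As 2 and 5 are coprime, the congruence modulo \<open>10 ^ n\<close> holds exactly for
  \<open>n\<close> up to the minimum; this also makes the \<open>THE\<close> well defined.\<close>

lemma stable_digits_eq_min_multiplicity:
  fixes a b :: nat
  assumes "a > 1"
  defines "d \<equiv> tetration a (Suc b) - tetration a b"
  shows "stable_digits a b = min (multiplicity 2 d) (multiplicity 5 d)"
proof -
  have "d > 0"
    unfolding d_def using tetration_less_Suc[OF assms(1), of b] by simp
  have "[tetration a b = tetration a (b + 1)] (mod 10 ^ n) \<longleftrightarrow>
      n \<le> min (multiplicity 2 d) (multiplicity 5 d)" for n
  proof -
    have "[tetration a b = tetration a (b + 1)] (mod 10 ^ n) \<longleftrightarrow> 10 ^ n dvd d"
      unfolding d_def using tetration_less_Suc[OF assms(1), of b]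
      by (metis Suc_eq_plus1 cong_altdef_nat cong_sym_eq less_imp_le)
    also have "\<dots> \<longleftrightarrow> 2 ^ n * 5 ^ n dvd d"
      by (simp flip: power_mult_distrib)
    also have "\<dots> \<longleftrightarrow> 2 ^ n dvd d \<and> 5 ^ n dvd d"
    proof -
      have "coprime (2::nat) 5"
        by (simp add: primes_coprime)
      then have "coprime ((2::nat) ^ n) (5 ^ n)"
        by simp
      then show ?thesis
        by (meson divides_mult dvd_mult_left dvd_mult_right)
    qed
    also have "\<dots> \<longleftrightarrow> n \<le> min (multiplicity 2 d) (multiplicity 5 d)"
      using \<open>d > 0\<close> by (simp add: power_dvd_iff_le_multiplicity)
    finally show ?thesis .
  qed
  then show ?thesis
    unfolding stable_digits_def by (simp only:) (intro the_equality; linarith)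
qed

section \<open>Valuations at 2 and 5 of powers and of tower differences\<close>

text \<open>Since 4 does not divide \<open>a - 1\<close>, the exponent is lifted from
  \<open>a\<^sup>2\<close>. The single factor 2 of \<open>a - 1\<close> makes up for the one lost in
  halving \<open>n\<close>.\<close>

lemma multiplicity_2_even_power_minus_1:
  fixes a n :: nat
  assumes "a mod 4 = 3" and "even n" and "n > 0"
  shows "multiplicity 2 (a ^ n - 1) = multiplicity 2 (a + 1) + multiplicity 2 n"
proof -
  obtain m where n: "n = 2 * m"
    using assms(2) ..
  have "a > 1"
    using assms(1) by (cases "a \<le> 1") (auto simp: le_Suc_eq)
  have "4 dvd a + 1" "multiplicity 2 (a - 1) = 1"
  proof -
    show "4 dvd a + 1"
      using assms(1) by presburger
    have "2 dvd a - 1" "\<not> 4 dvd a - 1"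
      using assms(1) by presburger+
    then show "multiplicity 2 (a - 1) = 1"
      by (intro multiplicity_eqI) auto
  qed
  have square: "a\<^sup>2 - 1 = (a + 1) * (a - 1)"
    by (simp add: power2_eq_square algebra_simps)
  have "multiplicity 2 (a ^ n - 1) = multiplicity 2 (a\<^sup>2 - 1) + multiplicity 2 m"
    unfolding n power_mult
  proof (rule multiplicity_power_minus_1_nat)
    show "4 dvd a\<^sup>2 - 1"
      unfolding square using \<open>4 dvd a + 1\<close> by (rule dvd_mult2)
    then show "2 dvd a\<^sup>2 - 1"
      by presburger
    show "a\<^sup>2 > 1" "m > 0"
      using one_less_power[OF \<open>a > 1\<close>, of 2] assms(3) n by simp_all
  qed simp
  also have "multiplicity 2 (a\<^sup>2 - 1) = multiplicity 2 (a + 1) + 1"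
    unfolding square using \<open>a > 1\<close> \<open>multiplicity 2 (a - 1) = 1\<close>
    by (subst prime_elem_multiplicity_mult_distrib) auto
  also have "multiplicity 2 n = Suc (multiplicity 2 m)"
    unfolding n using assms(3) n by (intro multiplicity_times_same) auto
  ultimately show ?thesis
    by simp
qed

text \<open>Modulo 5 the order of \<open>a\<close> is 4, so the exponent is lifted from
  \<open>a ^ 4\<close>; of its factors \<open>a\<^sup>2 + 1\<close> and
  \<open>a\<^sup>2 - 1\<close>, only the first is divisible by 5.\<close>

lemma multiplicity_5_power_minus_1:
  fixes a n :: nat
  assumes "a mod 5 = 2 \<or> a mod 5 = 3" and "4 dvd n" and "n > 0"
  shows "multiplicity 5 (a ^ n - 1) = multiplicity 5 (a\<^sup>2 + 1) + multiplicity 5 n"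
proof -
  obtain m where n: "n = 4 * m"
    using assms(2) ..
  have "a > 1"
    using assms(1) by (cases "a \<le> 1") (auto simp: le_Suc_eq)
  have a2: "a\<^sup>2 mod 5 = 4"
    using assms(1) by (auto simp: power_mod[symmetric, of a 2 5])
  have fourth: "a ^ 4 - 1 = (a\<^sup>2 + 1) * (a\<^sup>2 - 1)"
    by (simp add: power4_eq_xxxx power2_eq_square algebra_simps)
  have "multiplicity 5 (a ^ n - 1) = multiplicity 5 (a ^ 4 - 1) + multiplicity 5 m"
    unfolding n power_mult
  proof (rule multiplicity_power_minus_1_nat)
    have "5 dvd a\<^sup>2 + 1"
      using a2 by presburger
    then show "5 dvd a ^ 4 - 1"
      unfolding fourth by (rule dvd_mult2)
    show "a ^ 4 > 1" "m > 0"
      using one_less_power[OF \<open>a > 1\<close>, of 4] assms(3) n by simp_all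
  qed simp_all
  also have "multiplicity 5 (a ^ 4 - 1) = multiplicity 5 (a\<^sup>2 + 1)"
  proof -
    have "\<not> 5 dvd a\<^sup>2 - 1"
      using a2 by presburger
    then show ?thesis
      unfolding fourth using \<open>a > 1\<close>
      by (subst prime_elem_multiplicity_mult_distrib)
        (auto simp: not_dvd_imp_multiplicity_0)
  qed
  also have "multiplicity 5 n = multiplicity 5 m"
    unfolding n using assms(3) n
    by (subst prime_elem_multiplicity_mult_distrib) (auto simp: not_dvd_imp_multiplicity_0)
  ultimately show ?thesis
    by simp
qed

lemma multiplicity_2_tetration_diff:
  fixes a b :: nat
  assumes "a mod 4 = 3"
  shows "multiplicity 2 (tetration a (Suc b) - tetration a b) = b * multiplicity 2 (a + 1) + 1"
proof (induction b)
  case 0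
  \<comment> \<open>With the value 1 at height 0, the first difference is \<open>a - 1\<close>,
    which is 2 modulo 4.\<close>
  have "2 dvd a - 1" "\<not> 4 dvd a - 1"
    using assms by presburger+
  then show ?case
    by simp (intro multiplicity_eqI; simp)
next
  case (Suc b)
  define d where "d = tetration a (Suc b) - tetration a b"
  have "a > 1"
    using assms by (cases "a \<le> 1") (auto simp: le_Suc_eq)
  have "odd a"
    using assms by presburger
  have "d > 0"
    unfolding d_def using tetration_less_Suc[OF \<open>a > 1\<close>, of b] by simp
  have mult_d: "multiplicity 2 d = b * multiplicity 2 (a + 1) + 1"
    unfolding d_def by (fact Suc)
  then have "even d"
    by (metis Suc_eq_plus1 nat.distinct(1) not_dvd_imp_multiplicity_0)
  have "multiplicity 2 (tetration a (Suc (Suc b)) - tetration a (Suc b)) =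
      multiplicity 2 (tetration a (Suc b)) + multiplicity 2 (a ^ d - 1)"
    unfolding tetration_diff_Suc[OF \<open>a > 1\<close>] d_def[symmetric]
    using \<open>a > 1\<close> one_less_power[OF \<open>a > 1\<close> \<open>d > 0\<close>]
    by (intro prime_elem_multiplicity_mult_distrib) auto
  moreover have "multiplicity 2 (tetration a (Suc b)) = 0"
    using \<open>odd a\<close> by (simp add: not_dvd_imp_multiplicity_0)
  ultimately show ?case
    using multiplicity_2_even_power_minus_1[OF assms \<open>even d\<close> \<open>d > 0\<close>] mult_d by simp
qed

lemma multiplicity_5_tetration_diff:
  fixes a b :: nat
  assumes "a mod 4 = 3" and "a mod 5 = 2 \<or> a mod 5 = 3"
  shows "multiplicity 5 (tetration a (Suc (Suc b)) - tetration a (Suc b)) =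
    b * multiplicity 5 (a\<^sup>2 + 1)"
proof -
  define d where "d b = tetration a (Suc b) - tetration a b" for b
  have "a > 1"
    using assms(1) by (cases "a \<le> 1") (auto simp: le_Suc_eq)
  have d_pos: "d b > 0" for b
    unfolding d_def using tetration_less_Suc[OF \<open>a > 1\<close>, of b] by simp
  have "\<not> 5 dvd a"
    using assms(2) by presburger
  then have "\<not> 5 dvd tetration a (Suc b)" for b
    using prime_dvd_power[of 5 a] by auto
  then have mult_d_Suc: "multiplicity 5 (d (Suc b)) = multiplicity 5 (a ^ d b - 1)" for b
    unfolding d_def tetration_diff_Suc[OF \<open>a > 1\<close>]
    using \<open>a > 1\<close> one_less_power[OF \<open>a > 1\<close> d_pos[of b, unfolded d_def]]
    by (subst prime_elem_multiplicity_mult_distrib) (auto simp: not_dvd_imp_multiplicity_0)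
  have "multiplicity 5 (d (Suc b)) = b * multiplicity 5 (a\<^sup>2 + 1)"
  proof (induction b)
    case 0
    \<comment> \<open>The exponent \<open>a - 1\<close> is twice an odd number and
      \<open>a\<^sup>2\<close> is -1 modulo 5, so \<open>a ^ (a - 1)\<close> is -1 as well.\<close>
    obtain k where k: "a - 1 = 2 * (2 * k + 1)"
    proof
      show "a - 1 = 2 * (2 * (a div 4) + 1)"
        using assms(1) by presburger
    qed
    have "(a ^ 2) mod 5 = 4"
      using assms(2) by (auto simp: power_mod[symmetric, of a 2 5])
    moreover have "(4 ^ (2 * k + 1)) mod 5 = (4::nat)"
    proof -
      have "(16 ^ k) mod 5 = (1::nat)"
        using power_mod[of "16::nat" 5 k] by simp
      then show ?thesis
        by (simp add: power_mult) presburger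
    qed
    ultimately have "a ^ (a - 1) mod 5 = 4"
      unfolding k power_mult by (metis power_mod)
    then have "\<not> 5 dvd a ^ (a - 1) - 1"
      by presburger
    then show ?case
      unfolding mult_d_Suc by (simp add: d_def not_dvd_imp_multiplicity_0)
  next
    case (Suc b)
    \<comment> \<open>The 2-adic valuation shows that 4 divides the previous difference, as lifting
      from \<open>a ^ 4\<close> requires.\<close>
    have "4 dvd a + 1"
      using assms(1) by presburger
    then have "2 \<le> multiplicity 2 (a + 1)"
      by (intro multiplicity_geI) auto
    then have "2 \<le> multiplicity 2 (d (Suc b))"
      unfolding d_def multiplicity_2_tetration_diff[OF assms(1)] by simp
    then have "2 ^ 2 dvd d (Suc b)"
      by (rule multiplicity_dvd')
    then have "4 dvd d (Suc b)"
      by simp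
    then show ?case
      using multiplicity_5_power_minus_1[OF assms(2) _ d_pos] Suc
      unfolding mult_d_Suc[of "Suc b"] by simp
  qed
  then show ?thesis
    unfolding d_def .
qed

lemma stable_digits_Suc:
  fixes a b :: nat
  assumes "a mod 4 = 3" and "a mod 5 = 2 \<or> a mod 5 = 3"
  shows "stable_digits a (Suc b) =
    min (Suc b * multiplicity 2 (a + 1) + 1) (b * multiplicity 5 (a\<^sup>2 + 1))"
proof -
  have "a > 1"
    using assms(1) by (cases "a \<le> 1") (auto simp: le_Suc_eq)
  then show ?thesis
    by (simp only: stable_digits_eq_min_multiplicity multiplicity_2_tetration_diff[OF assms(1)]
        multiplicity_5_tetration_diff[OF assms])
qed

section \<open>From eventual behaviour to the minimal stable height\<close>

lemma constant_congruence_speed_eqI: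
  assumes "\<And>b. b \<ge> N \<Longrightarrow> congruence_speed a b = v"
  shows "constant_congruence_speed a = v"
proof -
  have ev: "\<forall>\<^sub>F b in sequentially. congruence_speed a b = v"
    using assms eventually_sequentially by blast
  show ?thesis
    unfolding constant_congruence_speed_def
  proof (rule the_equality[where P = "\<lambda>v. \<forall>\<^sub>F b in sequentially. congruence_speed a b = v"])
    show "w = v" if "\<forall>\<^sub>F b in sequentially. congruence_speed a b = w" for w
      using eventually_conj[OF that ev] unfolding eventually_sequentially by auto
  qed (fact ev)
qed

text \<open>Eventual constancy makes the \<open>LEAST\<close> exist. The constant value from there
  on is \<open>v\<close>, because the two tails overlap.\<close>

lemma congruence_speed_above_min_stable_height:
  assumes "\<And>b. b \<ge> N \<Longrightarrow> congruence_speed a b = v" and "b \<ge> min_stable_height a"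
  shows "congruence_speed a b = v"
proof -
  define m where "m = min_stable_height a"
  have "max 1 N \<ge> 1 \<and> (\<forall>k. congruence_speed a (max 1 N) = congruence_speed a (max 1 N + k))"
    using assms(1) by simp
  then have const: "congruence_speed a m = congruence_speed a (m + k)" for k
    unfolding m_def min_stable_height_def
    by (rule LeastI2) simp
  have "congruence_speed a b = congruence_speed a m"
    using const[of "b - m"] assms(2) unfolding m_def by simp
  also have "\<dots> = v"
    using const[of N] assms(1)[of "m + N"] by simp
  finally show ?thesis .
qed

text \<open>From height \<open>min_stable_height a - 1\<close> on, \<open>stable_digits\<close> is affine with slope \<open>v\<close>,
  so it agrees there with any affine function with which it agrees eventually.\<close>

lemma stable_digits_affine:
  assumes "\<And>b. b \<ge> N \<Longrightarrow> int (stable_digits a b) = int b * v + c"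
    and "b \<ge> 1" and "int b \<ge> int (min_stable_height a) - 1"
  shows "int (stable_digits a b) = int b * v + c"
proof -
  \<comment> \<open>The bound \<open>N + 2\<close> puts \<open>b - 1\<close> in the affine range and
    keeps \<open>b\<close> at least 2, where the speed is a difference.\<close>
  have speed: "congruence_speed a b = v" if "b \<ge> N + 2" for b
    using that assms(1)[of b] assms(1)[of "b - 1"]
    by (simp add: congruence_speed_def of_nat_diff algebra_simps)
  have "int (stable_digits a (b + k)) = int (stable_digits a b) + int k * v" for k
  proof (induction k)
    case (Suc k)
    \<comment> \<open>Only speeds at heights above \<open>b\<close> enter, so \<open>b\<close> may
      lie one below the minimal stable height.\<close>
    have "congruence_speed a (b + Suc k) = v"
      using assms(3) by (intro congruence_speed_above_min_stable_height[OF speed]) auto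
    then show ?case
      using Suc assms(2) by (simp add: congruence_speed_def algebra_simps)
  qed simp
  from this[of N] assms(1)[of "b + N"] show ?thesis
    by (simp add: algebra_simps)
qed

theorem mainTheorem9:
  fixes a :: nat
  assumes "a > 0"
    and "[a = 3] (mod 20) \<or> [a = 7] (mod 20)"
  shows "(\<forall>b::nat. b \<ge> 1 \<and> int b \<ge> int (min_stable_height a) - 1 \<longrightarrow>
            (congruence_speed a 2 = constant_congruence_speed a \<longrightarrow>
               int (stable_digits a b) = (int b - 1) * constant_congruence_speed a) \<and>
            (congruence_speed a 2 > constant_congruence_speed a \<longrightarrow>
               int (stable_digits a b) = int b * constant_congruence_speed a + 1)) \<and>
         (congruence_speed a 2 = constant_congruence_speed a \<or>
          congruence_speed a 2 > constant_congruence_speed a)"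
proof -
  have "a mod 20 = 3 \<or> a mod 20 = 7"
    using assms(2) by (simp add: cong_def)
  then have mod4: "a mod 4 = 3" and mod5: "a mod 5 = 2 \<or> a mod 5 = 3"
    using mod_mod_cancel[of 4 20 a] mod_mod_cancel[of 5 20 a] by auto
  define t where "t = multiplicity 2 (a + 1)"
  define s where "s = multiplicity 5 (a\<^sup>2 + 1)"
  have digits: "stable_digits a (Suc b) = min (Suc b * t + 1) (b * s)" for b
    unfolding t_def s_def by (rule stable_digits_Suc[OF mod4 mod5])
  \<comment> \<open>No digit is stable at height 1, because the 5-adic term vanishes there; so the
    speed at height 2 is the whole digit count.\<close>
  have speed2: "congruence_speed a 2 = int (min (2 * t + 1) s)"
    using digits[of 0] digits[of 1] by (simp add: congruence_speed_def numeral_2_eq_2)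
  show ?thesis
  proof (cases "s \<le> t")
    case True
    have digits': "int (stable_digits a b) = (int b - 1) * int s" if "b \<ge> 1" for b
    proof -
      have "(b - 1) * s \<le> b * t + 1"
        using mult_le_mono[of "b - 1" b s t] True by simp
      then show ?thesis
        using digits[of "b - 1"] that by (simp add: of_nat_diff)
    qed
    have "congruence_speed a b = int s" if "b \<ge> 2" for b
      using that by (simp add: congruence_speed_def digits' of_nat_diff left_diff_distrib)
    then have "constant_congruence_speed a = int s"
      by (rule constant_congruence_speed_eqI)
    then show ?thesis
      using speed2 True by (simp add: digits')
  next
    case False
    \<comment> \<open>With \<open>b = k + 1\<close>, the bound \<open>k \<ge> t + 1\<close> is what
      \<open>(k + 1) * t + 1 \<le> k * (t + 1)\<close> amounts to, and
      \<open>s \<ge> t + 1\<close>.\<close>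
    have eventual: "int (stable_digits a b) = int b * int t + 1" if "b \<ge> t + 2" for b
    proof -
      define k where "k = b - 1"
      have k: "b = Suc k" "k \<ge> t + 1"
        using that by (simp_all add: k_def)
      have "Suc k * t + 1 \<le> k * (t + 1)"
        using k by simp
      also have "\<dots> \<le> k * s"
        using False by (intro mult_le_mono2) simp
      finally show ?thesis
        using digits[of k] k(1) by (simp add: algebra_simps)
    qed
    have "congruence_speed a b = int t" if "b \<ge> t + 3" for b
      using that eventual[of b] eventual[of "b - 1"]
      by (simp add: congruence_speed_def of_nat_diff algebra_simps)
    then have speed: "constant_congruence_speed a = int t"
      by (rule constant_congruence_speed_eqI)
    then have "congruence_speed a 2 > constant_congruence_speed a"
      using speed2 False by simp
    then show ?thesis
      using stable_digits_affine[OF eventual] speed by auto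
  qed
qed

end
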